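(* Let $f\colon X\to\mathbb{R}$ be a filter on a Lefschetz complex and let $S\subseteq\mathrm{BD}(f)$ be shallow cancelable. Then the depth poset of $f^S\colon X^S\to\mathbb{R}$ is the restriction of the depth poset of $f$ to $\mathrm{BD}(f)\setminus S$.
   Context: Fix a field $\mathbb{F}$. A Lefschetz complex is a triple $(X,\dim,\kappa)$ with $X$ a finite set (of cells), $\dim\colon X\to\mathbb{Z}$, and an incidence map $\kappa\colon X\times X\to\mathbb{F}$ such that $\sum_{y\in X}\kappa(z,y)\kappa(y,x)=0$ for all $z,x\in X$, and $\kappa(y,x)\neq 0$ only if $\dim y=\dim x+1$. If $\kappa(y,x)\ne 0$, then $x$ is a facet of $y$ and $y$ is a cofacet of $x$. A filter on $X$ is an injective map $f\colon X\to\mathbb{R}$ with $f(x)<f(y)$ whenever $x$ is a facet of $y$. Birth-death pairs: order $X$ by $f$ and let $\Delta$ be the matrix with rows and columns indexed by $X$ in this order, $\Delta[x,y]=\kappa(y,x)$. A reduced form of $\Delta$ is a matrix $R=\Delta\cdot V$ with $V-\mathrm{Id}$ strictly upper triangular and such that the pivots (lowest non-zero entries) of the non-zero columns of $R$ lie in pairwise different rows. $\mathrm{BD}(f)$ is the set of pairs $(s,t)\in X\times X$ such that column $t$ of $R$ is non-zero and its pivot is in row $s$; this does not depend on the choice of $R$. Shallow pairs: $\mathrm{SH}(f)$ is the set of pairs $(s,t)$ such that $s$ is a facet of $t$, $f(x)\le f(s)$ for all facets $x$ of $t$, and $f(y)\ge f(t)$ for all cofacets $y$ of $s$. One has $\mathrm{SH}(f)\subseteq\mathrm{BD}(f)$.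 Cancellation: if $s$ is a facet of $t$, the quotient of $X$ by $(s,t)$ is the Lefschetz complex with cells $X\setminus\{s,t\}$, restricted dimension map, and incidence map $\kappa'(y,x)=\kappa(y,x)-\kappa(t,s)^{-1}\kappa(y,s)\kappa(t,x)$. If $(s,t)\in\mathrm{SH}(f)$, the restriction of $f$ is a filter on the quotient. Shallow orders: let $n=\#\mathrm{BD}(f)$. A shallow (cancellation) order of $f$ is an enumeration $\Phi=(\varphi_1,\dots,\varphi_n)$ of $\mathrm{BD}(f)$ such that, setting $X_0=X$, $f_0=f$, and letting $X_i$ be the quotient of $X_{i-1}$ by $\varphi_i$ and $f_i=f|_{X_i}$, one has $\varphi_i\in\mathrm{SH}(f_{i-1})$ for $i=1,\dots,n$. It is identified with the linear order $\varphi_i\le_\Phi\varphi_j\iff i\le j$. Depth poset: $\mathcal{D}_f$ is the partial order on $\mathrm{BD}(f)$ that is the intersection of all shallow orders of $f$: $\chi\le_f\xi$ iff $\chi\le_\Phi\xi$ for every shallow order $\Phi$ of $f$. The restriction of $\mathcal{D}_f$ to $P'\subseteq\mathrm{BD}(f)$ is $\mathcal{D}_f\cap(P'\times P')$. A set $S\subseteq\mathrm{BD}(f)$ is shallow cancelable if $S=\{\varphi_1,\dots,\varphi_k\}$ for some shallow order $(\varphi_1,\dots,\varphi_n)$ of $f$ and some $k$. In this case $X^S$ denotes the Lefschetz complex $X_k$ obtained by canceling $\varphi_1,\dots,\varphi_k$ in this order (it depends only on $S$, not on the chosen shallow order), and $f^S=f|_{X^S}$, which is a filter on $X^S$. *)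

theory Defs
  imports Complex_Main
begin

text \<open>
  The incidence map is total on the cell type; only its values on \<open>cells X\<close> are meaningful, and
  all notions below are relativised to \<open>cells X\<close>. In the same way a filter is a total function of
  which only the values on \<open>cells X\<close> matter, so that the restriction of a filter \<open>f\<close> to a quotient
  is represented by \<open>f\<close> itself.
\<close>

record ('a, 'k) lcomplex =
  cells :: "'a set"
  cdim :: "'a \<Rightarrow> int"
  incidence :: "'a \<Rightarrow> 'a \<Rightarrow> 'k"

definition lefschetz :: "('a, 'k::field) lcomplex \<Rightarrow> bool" where
  "lefschetz X \<longleftrightarrow>
     finite (cells X) \<and>
     (\<forall>z\<in>cells X. \<forall>x\<in>cells X. (\<Sum>y\<in>cells X. incidence X z y * incidence X y x) = 0) \<and>
     (\<forall>y\<in>cells X. \<forall>x\<in>cells X. incidence X y x \<noteq> 0 \<longrightarrow> cdim X y = cdim X x + 1)"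

definition facet :: "('a, 'k::field) lcomplex \<Rightarrow> 'a \<Rightarrow> 'a \<Rightarrow> bool" where
  "facet X x y \<longleftrightarrow> x \<in> cells X \<and> y \<in> cells X \<and> incidence X y x \<noteq> 0"

abbreviation cofacet :: "('a, 'k::field) lcomplex \<Rightarrow> 'a \<Rightarrow> 'a \<Rightarrow> bool" where
  "cofacet X y x \<equiv> facet X x y"

definition lfilter :: "('a, 'k::field) lcomplex \<Rightarrow> ('a \<Rightarrow> real) \<Rightarrow> bool" where
  "lfilter X f \<longleftrightarrow> inj_on f (cells X) \<and> (\<forall>x y. facet X x y \<longrightarrow> f x < f y)"

text \<open>
  Matrices are functions of a row index and a column index in \<open>cells X\<close>, which is ordered by the
  values of \<open>f\<close>; ``lower'' rows are those with larger value of \<open>f\<close>.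
\<close>

definition bd_matrix :: "('a, 'k::field) lcomplex \<Rightarrow> 'a \<Rightarrow> 'a \<Rightarrow> 'k" where
  "bd_matrix X = (\<lambda>x y. incidence X y x)"

definition matrix_prod ::
    "('a, 'k::field) lcomplex \<Rightarrow> ('a \<Rightarrow> 'a \<Rightarrow> 'k) \<Rightarrow> ('a \<Rightarrow> 'a \<Rightarrow> 'k) \<Rightarrow> 'a \<Rightarrow> 'a \<Rightarrow> 'k" where
  "matrix_prod X A B = (\<lambda>x z. \<Sum>y\<in>cells X. A x y * B y z)"

definition id_matrix :: "'a \<Rightarrow> 'a \<Rightarrow> 'k::field" where
  "id_matrix = (\<lambda>x y. if x = y then 1 else 0)"

definition strictly_upper ::
    "('a, 'k::field) lcomplex \<Rightarrow> ('a \<Rightarrow> real) \<Rightarrow> ('a \<Rightarrow> 'a \<Rightarrow> 'k) \<Rightarrow> bool" where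
  "strictly_upper X f A \<longleftrightarrow> (\<forall>x\<in>cells X. \<forall>y\<in>cells X. A x y \<noteq> 0 \<longrightarrow> f x < f y)"

text \<open>Column \<open>t\<close> of \<open>R\<close> is non-zero and its pivot is in row \<open>s\<close>.\<close>

definition pivot ::
    "('a, 'k::field) lcomplex \<Rightarrow> ('a \<Rightarrow> real) \<Rightarrow> ('a \<Rightarrow> 'a \<Rightarrow> 'k) \<Rightarrow> 'a \<Rightarrow> 'a \<Rightarrow> bool" where
  "pivot X f R s t \<longleftrightarrow> s \<in> cells X \<and> t \<in> cells X \<and> R s t \<noteq> 0 \<and>
     (\<forall>x\<in>cells X. f s < f x \<longrightarrow> R x t = 0)"

definition reduced_form ::
    "('a, 'k::field) lcomplex \<Rightarrow> ('a \<Rightarrow> real) \<Rightarrow> ('a \<Rightarrow> 'a \<Rightarrow> 'k) \<Rightarrow> bool" where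
  "reduced_form X f R \<longleftrightarrow>
     (\<exists>V. strictly_upper X f (\<lambda>x y. V x y - id_matrix x y) \<and>
          R = matrix_prod X (bd_matrix X) V) \<and>
     (\<forall>s t t'. pivot X f R s t \<and> pivot X f R s t' \<longrightarrow> t = t')"

text \<open>
  For a filter on a Lefschetz complex, reduced forms exist and all of them have the same pivots.
\<close>

definition BD :: "('a, 'k::field) lcomplex \<Rightarrow> ('a \<Rightarrow> real) \<Rightarrow> ('a \<times> 'a) set" where
  "BD X f = {(s, t). \<exists>R. reduced_form X f R \<and> pivot X f R s t}"

definition SH :: "('a, 'k::field) lcomplex \<Rightarrow> ('a \<Rightarrow> real) \<Rightarrow> ('a \<times> 'a) set" where
  "SH X f = {(s, t). facet X s t \<and>
     (\<forall>x. facet X x t \<longrightarrow> f x \<le> f s) \<and> (\<forall>y. cofacet X y s \<longrightarrow> f y \<ge> f t)}"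

definition quotient :: "('a, 'k::field) lcomplex \<Rightarrow> 'a \<times> 'a \<Rightarrow> ('a, 'k) lcomplex" where
  "quotient X = (\<lambda>(s, t).
     \<lparr> cells = cells X - {s, t},
       cdim = cdim X,
       incidence = (\<lambda>y x. incidence X y x
          - inverse (incidence X t s) * incidence X y s * incidence X t x) \<rparr>)"

definition quotients :: "('a, 'k::field) lcomplex \<Rightarrow> ('a \<times> 'a) list \<Rightarrow> ('a, 'k) lcomplex" where
  "quotients X \<Phi> = foldl quotient X \<Phi>"

definition shallow_order ::
    "('a, 'k::field) lcomplex \<Rightarrow> ('a \<Rightarrow> real) \<Rightarrow> ('a \<times> 'a) list \<Rightarrow> bool" where
  "shallow_order X f \<Phi> \<longleftrightarrow> distinct \<Phi> \<and> set \<Phi> = BD X f \<and>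
     (\<forall>i<length \<Phi>. \<Phi> ! i \<in> SH (quotients X (take i \<Phi>)) f)"

definition list_order :: "'b list \<Rightarrow> 'b rel" where
  "list_order \<Phi> = {(\<Phi> ! i, \<Phi> ! j) | i j. i \<le> j \<and> j < length \<Phi>}"

text \<open>
  The depth poset is given by its order relation. The relation is reflexive on \<open>BD X f\<close> and
  contained in \<open>BD X f \<times> BD X f\<close>, so it determines the ground set \<open>BD X f\<close>.
\<close>

definition depth_poset :: "('a, 'k::field) lcomplex \<Rightarrow> ('a \<Rightarrow> real) \<Rightarrow> ('a \<times> 'a) rel" where
  "depth_poset X f = {(\<chi>, \<xi>) \<in> BD X f \<times> BD X f.
     \<forall>\<Phi>. shallow_order X f \<Phi> \<longrightarrow> (\<chi>, \<xi>) \<in> list_order \<Phi>}"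

definition shallow_cancelable ::
    "('a, 'k::field) lcomplex \<Rightarrow> ('a \<Rightarrow> real) \<Rightarrow> ('a \<times> 'a) set \<Rightarrow> bool" where
  "shallow_cancelable X f S \<longleftrightarrow>
     (\<exists>\<Phi> k. shallow_order X f \<Phi> \<and> k \<le> length \<Phi> \<and> S = set (take k \<Phi>))"

text \<open>
  \<open>Y\<close> is the complex obtained from \<open>X\<close> by canceling the pairs of \<open>S\<close> along some shallow order
  that starts with \<open>S\<close>. On its cells, \<open>Y\<close> does not depend on the chosen shallow order.
\<close>

definition shallow_cancellation ::
    "('a, 'k::field) lcomplex \<Rightarrow> ('a \<Rightarrow> real) \<Rightarrow> ('a \<times> 'a) set \<Rightarrow> ('a, 'k) lcomplex \<Rightarrow> bool" where
  "shallow_cancellation X f S Y \<longleftrightarrow>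
     (\<exists>\<Phi> k. shallow_order X f \<Phi> \<and> k \<le> length \<Phi> \<and> S = set (take k \<Phi>) \<and>
            Y = quotients X (take k \<Phi>))"

end

theory Submission
  imports Defs
begin

text \<open>
  The order in which shallow pairs are canceled is immaterial in a strong sense. If \<open>p\<close> and \<open>q\<close> are
  distinct shallow pairs, then \<open>q\<close> is still shallow after \<open>p\<close> has been canceled
  (\<open>SH_quotient\<close>), and canceling \<open>p\<close> and \<open>q\<close> in either order gives the same complex
  (\<open>quotient_commute\<close>). Hence in any sequence of shallow cancellations a pair that is shallow
  at the start can be pulled to the front without disturbing the others
  (\<open>shallow_seq_remove1\<close>); iterating this, all of \<open>S\<close> can be pulled to the front of any shallow
  order of \<open>f\<close>, and what remains is a shallow order of \<open>f\<^sup>S\<close> in which the pairs outside \<open>S\<close> have kept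
  their relative order. Conversely, a shallow order of \<open>f\<^sup>S\<close> becomes one of \<open>f\<close> when the
  cancellations that lead to \<open>X\<^sup>S\<close> are put in front of it. So the shallow orders of
  \<open>f\<^sup>S\<close> are exactly the restrictions of the shallow orders of \<open>f\<close>, and intersecting them gives the
  claim.

  For this one has to know that a shallow cancellation removes exactly one birth-death pair
  (\<open>BD_quotient\<close>). Reduced matrices are awkward for that purpose, so \<open>BD\<close> is first described
  without them: \<open>(a, b)\<close> is a birth-death pair iff some chain supported on cells up to \<open>b\<close>,
  but no chain supported on cells before \<open>b\<close>, has a boundary whose last cell is \<open>a\<close> (\<open>BD_iff\<close>).
  Chains of the quotient and of the complex can be transported into each other with control over
  both the support and the last cell of the boundary, which gives the result.
\<close>

section \<open>Chains and the last cells of their boundaries\<close>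

definition boundary :: "('a, 'k::field) lcomplex \<Rightarrow> ('a \<Rightarrow> 'k) \<Rightarrow> 'a \<Rightarrow> 'k" where
  "boundary X v x = (\<Sum>y\<in>cells X. v y * incidence X y x)"

definition last_cell ::
    "('a, 'k::field) lcomplex \<Rightarrow> ('a \<Rightarrow> real) \<Rightarrow> ('a \<Rightarrow> 'k) \<Rightarrow> 'a \<Rightarrow> bool" where
  "last_cell X f w a \<longleftrightarrow> a \<in> cells X \<and> w a \<noteq> 0 \<and> (\<forall>x\<in>cells X. f a < f x \<longrightarrow> w x = 0)"

definition boundary_ends ::
    "('a, 'k::field) lcomplex \<Rightarrow> ('a \<Rightarrow> real) \<Rightarrow> 'a set \<Rightarrow> 'a set" where
  "boundary_ends X f D =
     {a. \<exists>v. (\<forall>y\<in>cells X. v y \<noteq> 0 \<longrightarrow> y \<in> D) \<and> last_cell X f (boundary X v) a}"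

lemma boundary_endsI:
  assumes "\<And>y. y \<in> cells X \<Longrightarrow> v y \<noteq> 0 \<Longrightarrow> y \<in> D" "last_cell X f (boundary X v) a"
  shows "a \<in> boundary_ends X f D"
  using assms unfolding boundary_ends_def by blast

lemma boundary_endsE:
  assumes "a \<in> boundary_ends X f D"
  obtains v where "\<And>y. y \<in> cells X \<Longrightarrow> v y \<noteq> 0 \<Longrightarrow> y \<in> D" "last_cell X f (boundary X v) a"
  using assms unfolding boundary_ends_def by blast

lemma boundary_add_scaled:
  "boundary X (\<lambda>y. v y + c * w y) x = boundary X v x + c * boundary X w x"
  by (simp add: boundary_def sum.distrib sum_distrib_left algebra_simps)

lemma boundary_diff_scaled:
  "boundary X (\<lambda>y. v y - c * w y) x = boundary X v x - c * boundary X w x"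
  using boundary_add_scaled[of X v "- c" w x] by simp

lemma boundary_scaled: "boundary X (\<lambda>y. c * v y) x = c * boundary X v x"
  by (simp add: boundary_def sum_distrib_left mult.assoc)

lemma boundary_single:
  assumes "finite (cells X)" "t \<in> cells X"
  shows "boundary X (\<lambda>y. if y = t then 1 else 0) x = incidence X t x"
proof -
  have "boundary X (\<lambda>y. if y = t then 1 else 0) x
      = (\<Sum>y\<in>cells X. if y = t then incidence X y x else 0)"
    unfolding boundary_def by (intro sum.cong) auto
  then show ?thesis using assms by simp
qed

lemma boundary_boundary:
  assumes "lefschetz X" "x \<in> cells X"
  shows "boundary X (boundary X v) x = 0"
proof -
  have "boundary X (boundary X v) x
      = (\<Sum>y\<in>cells X. \<Sum>z\<in>cells X. v z * (incidence X z y * incidence X y x))"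
    unfolding boundary_def by (simp add: sum_distrib_right mult.assoc)
  also have "\<dots> = (\<Sum>z\<in>cells X. v z * (\<Sum>y\<in>cells X. incidence X z y * incidence X y x))"
    by (subst sum.swap) (simp add: sum_distrib_left)
  also have "\<dots> = 0" using assms unfolding lefschetz_def by simp
  finally show ?thesis .
qed

lemma boundary_incidence:
  assumes "lefschetz X" "t \<in> cells X" "x \<in> cells X"
  shows "boundary X (incidence X t) x = 0"
  using assms unfolding lefschetz_def boundary_def by simp

lemma boundary_diff_incidence:
  assumes "lefschetz X" "t \<in> cells X" "x \<in> cells X"
  shows "boundary X (\<lambda>y. v y - c * incidence X t y) x = boundary X v x"
  using boundary_incidence[OF assms] by (simp add: boundary_diff_scaled)

lemma ex_last_cell:
  assumes "finite (cells X)" "x \<in> cells X" "w x \<noteq> 0"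
  shows "\<exists>a. last_cell X f w a \<and> f x \<le> f a"
proof -
  let ?A = "{y \<in> cells X. w y \<noteq> 0}"
  have fin: "finite ?A" and ne: "?A \<noteq> {}" using assms by auto
  obtain a where a: "a \<in> ?A" "f a = Max (f ` ?A)"
    using Max_in[of "f ` ?A"] fin ne by (metis (no_types, lifting) finite_imageI image_iff image_is_empty)
  have "f y \<le> f a" if "y \<in> ?A" for y using a(2) fin that by simp
  then have "last_cell X f w a" "f x \<le> f a" using a(1) assms unfolding last_cell_def by force+
  then show ?thesis by blast
qed

lemma last_cell_cong:
  assumes "last_cell X f w a" "\<And>x. x \<in> cells X \<Longrightarrow> f a \<le> f x \<Longrightarrow> w x = w' x"
  shows "last_cell X f w' a"
  using assms unfolding last_cell_def by force

section \<open>Birth-death pairs without reduced matrices\<close>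

lemma matrix_prod_bd: "matrix_prod X (bd_matrix X) V x t = boundary X (\<lambda>y. V y t) x"
  by (simp add: matrix_prod_def bd_matrix_def boundary_def mult.commute)

lemma pivot_iff: "pivot X f R s t \<longleftrightarrow> t \<in> cells X \<and> last_cell X f (\<lambda>x. R x t) s"
  unfolding pivot_def last_cell_def by blast

text \<open>
  The columns of \<open>V\<close> form a basis adapted to the filter, and the non-zero columns of a reduced
  form end in different cells, so that their last cells cannot cancel in a linear combination. Thus
  the last cell of any boundary already occurs as a pivot, in a column no later than the chain.
\<close>

lemma last_cell_is_pivot:
  fixes X :: "('a, 'k::field) lcomplex"
  assumes fin: "finite (cells X)" and inj: "inj_on f (cells X)"
    and V: "strictly_upper X f (\<lambda>x y. V x y - id_matrix x y)"
    and R: "R = matrix_prod X (bd_matrix X) V"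
    and red: "\<And>s t t'. pivot X f R s t \<Longrightarrow> pivot X f R s t' \<Longrightarrow> t = t'"
    and w: "\<And>y. y \<in> cells X \<Longrightarrow> w y \<noteq> 0 \<Longrightarrow> f y < r"
    and a: "last_cell X f (boundary X w) a"
  shows "\<exists>u. f u < r \<and> pivot X f R a u"
  using w a
proof (induction "card {y \<in> cells X. f y < r}" arbitrary: r w a rule: less_induct)
  case less
  have "\<exists>y\<in>cells X. w y \<noteq> 0"
  proof (rule ccontr)
    assume "\<not> ?thesis"
    then have "boundary X w a = 0" unfolding boundary_def by simp
    then show False using less.prems(2) unfolding last_cell_def by simp
  qed
  then obtain u where u: "last_cell X f w u" using ex_last_cell[OF fin, of _ w f] by blast
  then have uX: "u \<in> cells X" and wu: "w u \<noteq> 0"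
    and wu0: "\<And>y. y \<in> cells X \<Longrightarrow> f u < f y \<Longrightarrow> w y = 0"
    unfolding last_cell_def by auto
  have ur: "f u < r" using less.prems(1) uX wu by blast
  define w' where "w' = (\<lambda>y. w y - w u * V y u)"
  have Vuu: "V u u = 1"
    using V uX unfolding strictly_upper_def id_matrix_def by force
  have Vu: "V y u = 0" if "y \<in> cells X" "f u \<le> f y" "y \<noteq> u" for y
    using V uX that unfolding strictly_upper_def id_matrix_def by force
  have w': "f y < f u" if "y \<in> cells X" "w' y \<noteq> 0" for y
  proof (rule ccontr)
    assume "\<not> f y < f u"
    then have le: "f u \<le> f y" by simp
    show False
    proof (cases "y = u")
      case True
      then show False using that Vuu unfolding w'_def by simp
    next
      case False
      then have "f u < f y" using le inj uX that(1) by (metis inj_onD order_le_less)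
      then show False using that wu0[of y] Vu[of y] False unfolding w'_def by simp
    qed
  qed
  have bw': "boundary X w' x = boundary X w x - w u * R x u" for x
    unfolding w'_def R matrix_prod_bd by (rule boundary_diff_scaled)
  have "{y \<in> cells X. f y < f u} \<subset> {y \<in> cells X. f y < r}" using ur uX by force
  then have card: "card {y \<in> cells X. f y < f u} < card {y \<in> cells X. f y < r}"
    using fin by (intro psubset_card_mono) auto
  have IH: "\<exists>u'. f u' < f u \<and> pivot X f R a' u'" if "last_cell X f (boundary X w') a'" for a'
    using less.hyps[OF card w' that] .
  show ?case
  proof (cases "\<forall>x\<in>cells X. f a \<le> f x \<longrightarrow> boundary X w' x = 0")
    case True
    then have eq: "boundary X w x = w u * R x u" if "x \<in> cells X" "f a \<le> f x" for x
      using bw' that by simp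
    have "last_cell X f (\<lambda>x. w u * R x u) a"
      by (rule last_cell_cong[OF less.prems(2) eq])
    then have "pivot X f R a u" using wu uX unfolding pivot_iff last_cell_def by simp
    then show ?thesis using ur by blast
  next
    case False
    then obtain x where x: "x \<in> cells X" "f a \<le> f x" "boundary X w' x \<noteq> 0" by blast
    then obtain a' where a': "last_cell X f (boundary X w') a'" "f x \<le> f a'"
      using ex_last_cell[OF fin, of x "boundary X w'" f] by blast
    have le: "f a \<le> f a'" using x a' by simp
    obtain u' where u': "f u' < f u" "pivot X f R a' u'" using IH[OF a'(1)] by blast
    show ?thesis
    proof (cases "a' = a")
      case True
      then show ?thesis using u' ur by (intro exI[of _ u']) simp
    next
      case False
      have aX: "a \<in> cells X" "a' \<in> cells X" using less.prems(2) a' unfolding last_cell_def by auto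
      then have aa': "f a < f a'" using False le inj by (metis inj_onD order_le_less)
      have bw: "boundary X w x = 0" if "x \<in> cells X" "f a < f x" for x
        using less.prems(2) that unfolding last_cell_def by blast
      have "last_cell X f (\<lambda>x. - w u * R x u) a'"
        using a'(1)
        by (rule last_cell_cong) (use bw aa' bw' in auto)
      then have "pivot X f R a' u" using wu uX unfolding pivot_iff last_cell_def by simp
      then show ?thesis using red[OF u'(2)] u'(1) by blast
    qed
  qed
qed

definition monic_at ::
    "('a, 'k::field) lcomplex \<Rightarrow> ('a \<Rightarrow> real) \<Rightarrow> 'a \<Rightarrow> ('a \<Rightarrow> 'k) \<Rightarrow> bool" where
  "monic_at X f t v \<longleftrightarrow> v t = 1 \<and> (\<forall>y\<in>cells X. v y \<noteq> 0 \<longrightarrow> f y \<le> f t)"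

text \<open>
  The greedy choice that yields a reduced form: in each column take a chain whose boundary ends as
  early as possible.
\<close>

lemma ex_earliest_boundary:
  fixes X :: "('a, 'k::field) lcomplex"
  assumes fin: "finite (cells X)"
  shows "\<exists>v. monic_at X f t v \<and>
    (\<forall>a v'. last_cell X f (boundary X v) a \<and> monic_at X f t v' \<longrightarrow>
       (\<exists>x\<in>cells X. f a \<le> f x \<and> boundary X v' x \<noteq> 0))"
proof -
  define low where "low v = {x \<in> cells X. \<exists>y\<in>cells X. f x \<le> f y \<and> boundary X v y \<noteq> 0}" for v
  have "monic_at X f t (\<lambda>y. if y = t then 1 else 0)" unfolding monic_at_def by simp
  then obtain v where v: "monic_at X f t v"
    and least: "\<And>v'. monic_at X f t v' \<Longrightarrow> card (low v) \<le> card (low v')"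
    using ex_has_least_nat[of "monic_at X f t" _ "\<lambda>v. card (low v)"] by blast
  have "\<exists>x\<in>cells X. f a \<le> f x \<and> boundary X v' x \<noteq> 0"
    if a: "last_cell X f (boundary X v) a" and v': "monic_at X f t v'" for a v'
  proof (rule ccontr)
    assume "\<not> ?thesis"
    then have z: "f y < f a" if "y \<in> cells X" "boundary X v' y \<noteq> 0" for y
      using that by force
    have aX: "a \<in> cells X" "boundary X v a \<noteq> 0" using a unfolding last_cell_def by auto
    have "a \<in> low v" using aX unfolding low_def by auto
    moreover have "a \<notin> low v'" using z unfolding low_def by force
    moreover have "low v' \<subseteq> low v"
    proof
      fix x assume "x \<in> low v'"
      then obtain y where xy: "x \<in> cells X" "y \<in> cells X" "f x \<le> f y" "boundary X v' y \<noteq> 0"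
        unfolding low_def by blast
      then have "f x \<le> f a" using z[of y] by linarith
      then show "x \<in> low v" using xy(1) aX unfolding low_def by blast
    qed
    ultimately have "low v' \<subset> low v" by blast
    then have "card (low v') < card (low v)"
      using fin unfolding low_def by (intro psubset_card_mono) auto
    then show False using least[OF v'] by simp
  qed
  then show ?thesis using v by blast
qed

lemma BD_iff:
  fixes X :: "('a, 'k::field) lcomplex"
  assumes fin: "finite (cells X)" and inj: "inj_on f (cells X)"
  shows "(a, b) \<in> BD X f \<longleftrightarrow>
    b \<in> cells X \<and> a \<in> boundary_ends X f {y. f y \<le> f b} \<and> a \<notin> boundary_ends X f {y. f y < f b}"
proof
  assume "(a, b) \<in> BD X f"
  then obtain R V where R: "R = matrix_prod X (bd_matrix X) V"
    and V: "strictly_upper X f (\<lambda>x y. V x y - id_matrix x y)"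
    and red: "\<And>s t t'. pivot X f R s t \<Longrightarrow> pivot X f R s t' \<Longrightarrow> t = t'"
    and piv: "pivot X f R a b"
    unfolding BD_def reduced_form_def by blast
  have bX: "b \<in> cells X" and low: "last_cell X f (\<lambda>x. R x b) a" using piv unfolding pivot_iff by auto
  have "a \<in> boundary_ends X f {y. f y \<le> f b}"
  proof (rule boundary_endsI)
    show "last_cell X f (boundary X (\<lambda>y. V y b)) a"
      using low unfolding R matrix_prod_bd .
    show "y \<in> {y. f y \<le> f b}" if "y \<in> cells X" "V y b \<noteq> 0" for y
      using V bX that unfolding strictly_upper_def id_matrix_def by (cases "y = b") force+
  qed
  moreover have "a \<notin> boundary_ends X f {y. f y < f b}"
  proof
    assume "a \<in> boundary_ends X f {y. f y < f b}"
    then obtain w where w: "\<And>y. y \<in> cells X \<Longrightarrow> w y \<noteq> 0 \<Longrightarrow> f y < f b"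
      and wa: "last_cell X f (boundary X w) a"
      by (elim boundary_endsE) auto
    have "\<exists>u. f u < f b \<and> pivot X f R a u"
      by (rule last_cell_is_pivot[OF fin inj V R _ _ wa]) (erule (1) red, erule (1) w)
    then obtain u where "f u < f b" "pivot X f R a u" by blast
    then show False using red piv by blast
  qed
  ultimately show "b \<in> cells X \<and> a \<in> boundary_ends X f {y. f y \<le> f b}
      \<and> a \<notin> boundary_ends X f {y. f y < f b}" using bX by blast
next
  assume "b \<in> cells X \<and> a \<in> boundary_ends X f {y. f y \<le> f b}
    \<and> a \<notin> boundary_ends X f {y. f y < f b}"
  then have bX: "b \<in> cells X" and ab: "a \<in> boundary_ends X f {y. f y \<le> f b}"
    and nab: "a \<notin> boundary_ends X f {y. f y < f b}" by auto
  obtain V' where "\<forall>t. monic_at X f t (V' t) \<and>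
      (\<forall>a v'. last_cell X f (boundary X (V' t)) a \<and> monic_at X f t v' \<longrightarrow>
         (\<exists>x\<in>cells X. f a \<le> f x \<and> boundary X v' x \<noteq> 0))"
    using ex_earliest_boundary[OF fin, of f] by metis
  then have monic: "\<And>t. monic_at X f t (V' t)"
    and earliest: "\<And>t a v'. last_cell X f (boundary X (V' t)) a \<Longrightarrow> monic_at X f t v' \<Longrightarrow>
         \<exists>x\<in>cells X. f a \<le> f x \<and> boundary X v' x \<noteq> 0"
    by blast+
  define R where "R = matrix_prod X (bd_matrix X) (\<lambda>x y. V' y x)"
  have Rb: "R x t = boundary X (V' t) x" for x t unfolding R_def matrix_prod_bd ..
  have upper: "strictly_upper X f (\<lambda>x y. V' y x - id_matrix x y)"
    unfolding strictly_upper_def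
  proof (intro ballI impI)
    fix x y assume xy: "x \<in> cells X" "y \<in> cells X" "V' y x - id_matrix x y \<noteq> 0"
    then have "x \<noteq> y" using monic[of y] unfolding monic_at_def id_matrix_def by auto
    moreover from this have "V' y x \<noteq> 0" using xy(3) unfolding id_matrix_def by simp
    then have "f x \<le> f y" using monic[of y] xy unfolding monic_at_def by blast
    ultimately show "f x < f y" using inj xy by (metis inj_onD order_le_less)
  qed
  \<comment> \<open>Two columns with the same last cell could be combined into one that ends earlier.\<close>
  have no: False if s: "pivot X f R s t" "pivot X f R s t'" and tt': "f t' < f t" for s t t'
  proof -
    have l: "last_cell X f (boundary X (V' t)) s" "last_cell X f (boundary X (V' t')) s"
      using s unfolding pivot_iff Rb by auto
    define c where "c = boundary X (V' t) s / boundary X (V' t') s"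
    have sX: "s \<in> cells X" and ns: "boundary X (V' t') s \<noteq> 0" using l unfolding last_cell_def by auto
    have tX: "t \<in> cells X" using s unfolding pivot_def by blast
    have "V' t' t = 0" using monic[of t'] tt' tX unfolding monic_at_def by force
    then have "monic_at X f t (\<lambda>y. V' t y - c * V' t' y)"
      using monic[of t] monic[of t'] tt' unfolding monic_at_def by force
    from earliest[OF l(1) this] obtain x where x: "x \<in> cells X" "f s \<le> f x"
      "boundary X (V' t) x - c * boundary X (V' t') x \<noteq> 0"
      unfolding boundary_diff_scaled by blast
    show False
    proof (cases "x = s")
      case True
      then show False using x ns unfolding c_def by simp
    next
      case False
      then have "f s < f x" using x sX inj by (metis inj_onD order_le_less)
      then show False using l x unfolding last_cell_def by simp
    qed
  qed
  have "reduced_form X f R"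
    unfolding reduced_form_def
  proof (intro conjI exI allI impI)
    show "strictly_upper X f (\<lambda>x y. V' y x - id_matrix x y)" by (rule upper)
    show "R = matrix_prod X (bd_matrix X) (\<lambda>x y. V' y x)" by (rule R_def)
    fix s t t' assume st: "pivot X f R s t \<and> pivot X f R s t'"
    then have "t \<in> cells X" "t' \<in> cells X" unfolding pivot_def by auto
    moreover have "f t = f t'" using no st by (metis linorder_neqE_linordered_idom)
    ultimately show "t = t'" using inj by (meson inj_onD)
  qed
  moreover have "pivot X f R a b"
  proof -
    from ab obtain v where v: "\<And>y. y \<in> cells X \<Longrightarrow> v y \<noteq> 0 \<Longrightarrow> f y \<le> f b"
      and va: "last_cell X f (boundary X v) a" by (elim boundary_endsE) auto
    have nz: "v b \<noteq> 0"
    proof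
      assume "v b = 0"
      have "a \<in> boundary_ends X f {y. f y < f b}"
      proof (rule boundary_endsI[OF _ va])
        fix y assume y: "y \<in> cells X" "v y \<noteq> 0"
        then have "y \<noteq> b" "f y \<le> f b" using \<open>v b = 0\<close> v by auto
        then show "y \<in> {y. f y < f b}" using inj y bX by (auto dest: inj_onD simp: order_le_less)
      qed
      then show False using nab by blast
    qed
    \<comment> \<open>Subtracting the chosen monic chain at \<open>b\<close> leaves a chain supported before \<open>b\<close>, whose
      boundary must not end in \<open>a\<close>; as both boundaries end no later than \<open>a\<close>, the chosen one
      must end exactly there.\<close>
    define d where "d = (\<lambda>y. v y - v b * V' b y)"
    have d: "f y < f b" if "y \<in> cells X" "d y \<noteq> 0" for y
    proof -
      have "y \<noteq> b" using that monic[of b] unfolding d_def monic_at_def by auto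
      moreover have "f y \<le> f b" using that monic[of b] v[of y] unfolding d_def monic_at_def by force
      ultimately show ?thesis using inj that bX by (metis inj_onD order_le_less)
    qed
    have bd: "boundary X d x = boundary X v x - v b * boundary X (V' b) x" for x
      unfolding d_def by (rule boundary_diff_scaled)
    have aX: "a \<in> cells X" and va0: "boundary X v a \<noteq> 0"
      and vz: "\<And>x. x \<in> cells X \<Longrightarrow> f a < f x \<Longrightarrow> boundary X v x = 0"
      using va unfolding last_cell_def by auto
    have high: "boundary X (V' b) x = 0" if x: "x \<in> cells X" "f a < f x" for x
    proof (rule ccontr)
      assume "boundary X (V' b) x \<noteq> 0"
      then obtain a' where a': "last_cell X f (boundary X (V' b)) a'" "f x \<le> f a'"
        using ex_last_cell[OF fin x(1), of "boundary X (V' b)" f] by blast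
      have "monic_at X f b (\<lambda>y. inverse (v b) * v y)"
        using nz v unfolding monic_at_def by simp
      from earliest[OF a'(1) this] obtain z where
        z: "z \<in> cells X" "f a' \<le> f z" "boundary X (\<lambda>y. inverse (v b) * v y) z \<noteq> 0" by blast
      then have "boundary X v z \<noteq> 0" by (simp add: boundary_scaled)
      then show False using vz[OF z(1)] z(2) a'(2) x(2) by linarith
    qed
    have "boundary X (V' b) a \<noteq> 0"
    proof
      assume z: "boundary X (V' b) a = 0"
      have "last_cell X f (boundary X d) a"
        unfolding last_cell_def bd using aX va0 z vz high by simp
      then have "a \<in> boundary_ends X f {y. f y < f b}"
        using d by (intro boundary_endsI[of X d]) auto
      then show False using nab by blast
    qed
    then show ?thesis unfolding pivot_iff Rb last_cell_def using bX aX high by blast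
  qed
  ultimately show "(a, b) \<in> BD X f" unfolding BD_def by blast
qed

section \<open>Canceling one shallow pair\<close>

lemma cells_quotient [simp]: "cells (quotient X (s, t)) = cells X - {s, t}"
  by (simp add: quotient_def)

lemma cdim_quotient [simp]: "cdim (quotient X (s, t)) = cdim X"
  by (simp add: quotient_def)

lemma incidence_quotient:
  "incidence (quotient X (s, t)) y x
     = incidence X y x - inverse (incidence X t s) * incidence X y s * incidence X t x"
  by (simp add: quotient_def)

lemma shallow_pairD:
  assumes "(s, t) \<in> SH X f"
  shows "s \<in> cells X" "t \<in> cells X" "incidence X t s \<noteq> 0"
    and "\<And>x. x \<in> cells X \<Longrightarrow> incidence X t x \<noteq> 0 \<Longrightarrow> f x \<le> f s"
    and "\<And>y. y \<in> cells X \<Longrightarrow> incidence X y s \<noteq> 0 \<Longrightarrow> f t \<le> f y"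
  using assms unfolding SH_def facet_def by auto

lemma shallow_pairI:
  assumes "s \<in> cells X" "t \<in> cells X" "incidence X t s \<noteq> 0"
    and "\<And>x. x \<in> cells X \<Longrightarrow> incidence X t x \<noteq> 0 \<Longrightarrow> f x \<le> f s"
    and "\<And>y. y \<in> cells X \<Longrightarrow> incidence X y s \<noteq> 0 \<Longrightarrow> f t \<le> f y"
  shows "(s, t) \<in> SH X f"
  using assms unfolding SH_def facet_def by auto

lemma lfilter_less:
  assumes "lfilter X f" "x \<in> cells X" "y \<in> cells X" "incidence X y x \<noteq> 0"
  shows "f x < f y"
  using assms unfolding lfilter_def facet_def by blast

lemma lfilter_inj: "lfilter X f \<Longrightarrow> inj_on f (cells X)"
  unfolding lfilter_def by blast

lemma lefschetz_finite: "lefschetz X \<Longrightarrow> finite (cells X)"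
  unfolding lefschetz_def by blast

lemma lefschetz_quotient:
  fixes X :: "('a, 'k::field) lcomplex"
  assumes X: "lefschetz X" and st: "s \<in> cells X" "t \<in> cells X" "incidence X t s \<noteq> 0"
  shows "lefschetz (quotient X (s, t))"
  unfolding lefschetz_def
proof (intro conjI ballI impI)
  let ?Q = "quotient X (s, t)" and ?l = "inverse (incidence X t s)"
  note fin = lefschetz_finite[OF X]
  show "finite (cells ?Q)" using fin by simp
  fix z x assume zx: "z \<in> cells ?Q" "x \<in> cells ?Q"
  have zero: "(\<Sum>y\<in>cells X. incidence X u y * incidence X y w) = 0"
    if "u \<in> cells X" "w \<in> cells X" for u w
    using X that unfolding lefschetz_def by blast
  have row: "incidence ?Q z s = 0" and col: "incidence ?Q t x = 0"
    using st(3) by (simp_all add: incidence_quotient)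
  \<comment> \<open>By \<open>row\<close> and \<open>col\<close> the terms at \<open>s\<close> and \<open>t\<close> vanish and may be put back into the sum.\<close>
  have "(\<Sum>y\<in>cells ?Q. incidence ?Q z y * incidence ?Q y x)
      = (\<Sum>y\<in>cells X. incidence ?Q z y * incidence ?Q y x)"
    using fin row col by (intro sum.mono_neutral_left) auto
  also have "\<dots> = (\<Sum>y\<in>cells X. incidence X z y * incidence X y x
      - ?l * incidence X t x * (incidence X z y * incidence X y s)
      - ?l * incidence X z s * (incidence X t y * incidence X y x)
      + ?l * ?l * incidence X z s * incidence X t x * (incidence X t y * incidence X y s))"
    by (intro sum.cong refl) (simp add: incidence_quotient algebra_simps)
  also have "\<dots> = (\<Sum>y\<in>cells X. incidence X z y * incidence X y x)
      - ?l * incidence X t x * (\<Sum>y\<in>cells X. incidence X z y * incidence X y s)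
      - ?l * incidence X z s * (\<Sum>y\<in>cells X. incidence X t y * incidence X y x)
      + ?l * ?l * incidence X z s * incidence X t x
        * (\<Sum>y\<in>cells X. incidence X t y * incidence X y s)"
    by (simp only: sum.distrib sum_subtractf sum_distrib_left)
  also have "\<dots> = 0" using zero st zx by simp
  finally show "(\<Sum>y\<in>cells ?Q. incidence ?Q z y * incidence ?Q y x) = 0" .
next
  fix y x assume yx: "y \<in> cells (quotient X (s, t))" "x \<in> cells (quotient X (s, t))"
    and nz: "incidence (quotient X (s, t)) y x \<noteq> 0"
  have dim: "cdim X v = cdim X u + 1"
    if "v \<in> cells X" "u \<in> cells X" "incidence X v u \<noteq> 0" for u v
    using X that unfolding lefschetz_def by blast
  show "cdim (quotient X (s, t)) y = cdim (quotient X (s, t)) x + 1"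
  proof (cases "incidence X y x = 0")
    case True
    then have "incidence X y s \<noteq> 0" "incidence X t x \<noteq> 0"
      using nz by (auto simp: incidence_quotient)
    then have "cdim X y = cdim X s + 1" "cdim X t = cdim X x + 1"
      using dim[of y s] dim[of t x] st yx by simp_all
    then show ?thesis using dim[OF st(2,1,3)] by simp
  next
    case False
    then show ?thesis using dim yx by simp
  qed
qed

lemma lfilter_quotient:
  assumes f: "lfilter X f" and st: "(s, t) \<in> SH X f"
  shows "lfilter (quotient X (s, t)) f"
  unfolding lfilter_def
proof (intro conjI allI impI)
  show "inj_on f (cells (quotient X (s, t)))"
    using lfilter_inj[OF f] by (auto intro: inj_on_subset)
  fix x y assume "facet (quotient X (s, t)) x y"
  then have xy: "x \<in> cells X" "y \<in> cells X" and nz: "incidence (quotient X (s, t)) y x \<noteq> 0"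
    unfolding facet_def by auto
  note st = shallow_pairD[OF st]
  show "f x < f y"
  proof (cases "incidence X y x = 0")
    case True
    then have "incidence X y s \<noteq> 0" "incidence X t x \<noteq> 0"
      using nz by (auto simp: incidence_quotient)
    then have "f t \<le> f y" "f x \<le> f s" using st xy by auto
    moreover have "f s < f t" using lfilter_less[OF f] st by blast
    ultimately show ?thesis by simp
  next
    case False
    then show ?thesis using lfilter_less[OF f] xy by blast
  qed
qed

text \<open>
  In the square of the boundary, the term of \<open>u\<close>, \<open>t\<close>, \<open>s\<close> has to be canceled by that of another
  cell between \<open>s\<close> and \<open>u\<close>. But \<open>t\<close> is the first cofacet of \<open>s\<close> and the last facet of \<open>u\<close>, so there
  is no such cell.
\<close>

lemma SH_consecutive:
  assumes X: "lefschetz X" and f: "lfilter X f"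
    and st: "(s, t) \<in> SH X f" and tu: "(t, u) \<in> SH X f"
  shows False
proof -
  note st = shallow_pairD[OF st] and tu = shallow_pairD[OF tu]
  have zero: "incidence X u y * incidence X y s = 0" if y: "y \<in> cells X - {t}" for y
  proof (rule ccontr)
    assume "\<not> ?thesis"
    then have "f y \<le> f t" "f t \<le> f y" using st tu y by auto
    then show False using lfilter_inj[OF f] y st by (auto dest: inj_onD)
  qed
  have "(\<Sum>y\<in>cells X - {t}. incidence X u y * incidence X y s) = 0"
    by (intro sum.neutral ballI zero)
  moreover have "(\<Sum>y\<in>cells X. incidence X u y * incidence X y s) = 0"
    using X st tu unfolding lefschetz_def by blast
  ultimately have "incidence X u t * incidence X t s = 0"
    using sum.remove[OF lefschetz_finite[OF X] st(2), of "\<lambda>y. incidence X u y * incidence X y s"]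
    by simp
  then show False using st tu by simp
qed

lemma SH_disjoint:
  assumes X: "lefschetz X" and f: "lfilter X f"
    and st: "(s, t) \<in> SH X f" and ab: "(a, b) \<in> SH X f" and ne: "(s, t) \<noteq> (a, b)"
  shows "{s, t} \<inter> {a, b} = {}"
proof -
  note st' = shallow_pairD[OF st] and ab' = shallow_pairD[OF ab] and inj = lfilter_inj[OF f]
  have "s \<noteq> a" using st' ab' inj ne by (metis inj_onD order_antisym)
  moreover have "t \<noteq> b" using st' ab' inj ne by (metis inj_onD order_antisym)
  moreover have "t \<noteq> a" "s \<noteq> b" using SH_consecutive[OF X f] st ab by blast+
  ultimately show ?thesis by auto
qed

lemma SH_cross_zero:
  assumes f: "lfilter X f" and st: "(s, t) \<in> SH X f" and ab: "(a, b) \<in> SH X f" and "s \<noteq> a"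
  shows "incidence X b s * incidence X t a = 0"
proof (rule ccontr)
  assume "\<not> ?thesis"
  then have "f s \<le> f a" "f a \<le> f s" using shallow_pairD[OF st] shallow_pairD[OF ab] by auto
  then show False
    using lfilter_inj[OF f] \<open>s \<noteq> a\<close> shallow_pairD(1)[OF st] shallow_pairD(1)[OF ab]
    by (auto dest: inj_onD)
qed

text \<open>
  Canceling \<open>(s, t)\<close> gives \<open>y\<close> a new facet \<open>x\<close> only if \<open>s\<close> is a facet of \<open>y\<close> and \<open>x\<close> one of \<open>t\<close>.
  For \<open>y = b\<close> such an \<open>x\<close> comes no later than \<open>s\<close>, and \<open>s\<close> no later than \<open>a\<close>, so that \<open>a\<close> remains the last
  facet of \<open>b\<close>; dually, \<open>b\<close> remains the first cofacet of \<open>a\<close>.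
\<close>

lemma SH_quotient:
  assumes X: "lefschetz X" and f: "lfilter X f"
    and p: "p \<in> SH X f" and q: "q \<in> SH X f" and ne: "p \<noteq> q"
  shows "q \<in> SH (quotient X p) f"
proof -
  obtain s t a b where pq: "p = (s, t)" "q = (a, b)" by (metis surj_pair)
  have st: "(s, t) \<in> SH X f" and ab: "(a, b) \<in> SH X f" using p q pq by auto
  note st' = shallow_pairD[OF st] and ab' = shallow_pairD[OF ab]
  have dis: "{s, t} \<inter> {a, b} = {}" using SH_disjoint[OF X f st ab] ne pq by blast
  have nz: "incidence (quotient X (s, t)) b a \<noteq> 0"
    using SH_cross_zero[OF f st ab] dis ab'(3) by (auto simp: incidence_quotient)
  show ?thesis
    unfolding pq
  proof (rule shallow_pairI)
    show "a \<in> cells (quotient X (s, t))" "b \<in> cells (quotient X (s, t))" using ab' dis by auto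
    show "incidence (quotient X (s, t)) b a \<noteq> 0" by (rule nz)
  next
    fix x assume x: "x \<in> cells (quotient X (s, t))" "incidence (quotient X (s, t)) b x \<noteq> 0"
    show "f x \<le> f a"
    proof (cases "incidence X b x = 0")
      case True
      then have "incidence X b s \<noteq> 0" "incidence X t x \<noteq> 0"
        using x by (auto simp: incidence_quotient)
      then have "f x \<le> f s" "f s \<le> f a" using x st' ab' by auto
      then show ?thesis by simp
    next
      case False
      then show ?thesis using x ab' by simp
    qed
  next
    fix y assume y: "y \<in> cells (quotient X (s, t))" "incidence (quotient X (s, t)) y a \<noteq> 0"
    show "f b \<le> f y"
    proof (cases "incidence X y a = 0")
      case True
      then have "incidence X y s \<noteq> 0" "incidence X t a \<noteq> 0"
        using y by (auto simp: incidence_quotient)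
      then have "f b \<le> f t" "f t \<le> f y" using y st' ab' by auto
      then show ?thesis by simp
    next
      case False
      then show ?thesis using y ab' by simp
    qed
  qed
qed

text \<open>
  In general the second cancellation would divide by an entry that the first one has changed.
  For two shallow pairs \<open>SH_cross_zero\<close> keeps both pivot entries, and then the result is
  symmetric in the two pairs.
\<close>

lemma quotient_commute:
  fixes X :: "('a, 'k::field) lcomplex"
  assumes X: "lefschetz X" and f: "lfilter X f"
    and p: "p \<in> SH X f" and q: "q \<in> SH X f" and ne: "p \<noteq> q"
  shows "quotient (quotient X p) q = quotient (quotient X q) p"
proof -
  obtain s t a b where pq: "p = (s, t)" "q = (a, b)" by (metis surj_pair)
  have st: "(s, t) \<in> SH X f" and ab: "(a, b) \<in> SH X f" using p q pq by auto
  have dis: "{s, t} \<inter> {a, b} = {}" using SH_disjoint[OF X f st ab] ne pq by blast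
  then have cross: "incidence X b s * incidence X t a = 0" "incidence X t a * incidence X b s = 0"
    using SH_cross_zero[OF f st ab] by auto
  have piv: "incidence (quotient X (s, t)) b a = incidence X b a"
    "incidence (quotient X (a, b)) t s = incidence X t s"
    using cross by (auto simp: incidence_quotient)
  let ?l = "inverse (incidence X t s)" and ?m = "inverse (incidence X b a)"
  have inc: "incidence (quotient (quotient X (s, t)) (a, b)) y x
      = incidence (quotient (quotient X (a, b)) (s, t)) y x" for y x
  proof -
    have "incidence (quotient (quotient X (s, t)) (a, b)) y x
        - incidence (quotient (quotient X (a, b)) (s, t)) y x
        = (incidence X b s * incidence X t a) *
          (?l * ?m * ?m * incidence X y a * incidence X b x
           - ?l * ?l * ?m * incidence X y s * incidence X t x)"
      unfolding incidence_quotient[of "quotient X (s, t)"] incidence_quotient[of "quotient X (a, b)"]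
        piv
      by (simp add: incidence_quotient algebra_simps)
    then show ?thesis using cross by simp
  qed
  show ?thesis
    unfolding pq
    by (rule lcomplex.equality) (use inc in \<open>auto simp: fun_eq_iff\<close>)
qed

section \<open>Birth-death pairs of a quotient\<close>

text \<open>
  A chain \<open>v\<close> of the quotient is lifted to \<open>X\<close> by adding the multiple of \<open>t\<close> that removes \<open>s\<close> from
  its boundary; the correction term in the incidence map of the quotient is the boundary of that
  multiple.
\<close>

lemma boundary_lift:
  fixes X :: "('a, 'k::field) lcomplex"
  assumes fin: "finite (cells X)" and st: "s \<in> cells X" "t \<in> cells X" "incidence X t s \<noteq> 0"
    and v: "v s = 0" "v t = 0"
  shows "boundary X (\<lambda>y. v y - boundary X v s / incidence X t s * (if y = t then 1 else 0)) x
    = boundary (quotient X (s, t)) v x"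
proof -
  have eq: "(\<Sum>y\<in>cells X - {s, t}. v y * g y) = (\<Sum>y\<in>cells X. v y * g y)" for g
    using fin v by (intro sum.mono_neutral_left) auto
  have "boundary (quotient X (s, t)) v x
      = (\<Sum>y\<in>cells X. v y * (incidence X y x
          - inverse (incidence X t s) * incidence X y s * incidence X t x))"
    by (simp add: boundary_def incidence_quotient eq)
  also have "\<dots> = boundary X v x - boundary X v s / incidence X t s * incidence X t x"
    unfolding boundary_def
    by (simp add: right_diff_distrib sum_subtractf sum_distrib_right sum_distrib_left
        divide_inverse mult.assoc mult.left_commute)
  finally show ?thesis
    unfolding boundary_diff_scaled boundary_single[OF fin st(2)] by (rule sym)
qed

text \<open>
  Lifting a chain adds \<open>t\<close> only if a cofacet of \<open>s\<close> is present, and \<open>t\<close> comes before all of these;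
  hence lifts stay inside any set that is closed under going back in the filter. Conversely, a chain
  of \<open>X\<close> can be freed of \<open>s\<close> and \<open>t\<close>. In the quotient this changes its boundary by a multiple of the
  boundary of \<open>t\<close>, which ends in \<open>s\<close>; the multiple is non-zero only if the original boundary
  contains \<open>s\<close> and thus, as its last cell \<open>a\<close> is not \<open>s\<close>, ends after \<open>s\<close>.
\<close>

lemma boundary_ends_quotient:
  fixes X :: "('a, 'k::field) lcomplex"
  assumes X: "lefschetz X" and f: "lfilter X f" and st: "(s, t) \<in> SH X f"
    and D: "\<And>x y. y \<in> D \<Longrightarrow> f x \<le> f y \<Longrightarrow> x \<in> D"
    and a: "a \<in> cells (quotient X (s, t))"
  shows "a \<in> boundary_ends (quotient X (s, t)) f D \<longleftrightarrow> a \<in> boundary_ends X f D"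
proof -
  let ?Q = "quotient X (s, t)"
  note st' = shallow_pairD[OF st] and fin = lefschetz_finite[OF X] and inj = lfilter_inj[OF f]
  have lt: "f s < f t" using lfilter_less[OF f] st' by blast
  have aX: "a \<in> cells X" "a \<noteq> s" "a \<noteq> t" using a by auto
  show ?thesis
  proof
    assume "a \<in> boundary_ends ?Q f D"
    then obtain v0 where v0: "\<And>y. y \<in> cells ?Q \<Longrightarrow> v0 y \<noteq> 0 \<Longrightarrow> y \<in> D"
      and low0: "last_cell ?Q f (boundary ?Q v0) a" by (elim boundary_endsE) auto
    define v where "v = (\<lambda>y. if y = s \<or> y = t then 0 else v0 y)"
    have vst: "v s = 0" "v t = 0" unfolding v_def by auto
    have vD: "y \<in> D" if "y \<in> cells X" "v y \<noteq> 0" for y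
      using v0[of y] that unfolding v_def by (auto split: if_splits)
    have "boundary ?Q v0 = boundary ?Q v"
      unfolding boundary_def v_def by (intro ext sum.cong) auto
    then have low: "last_cell ?Q f (boundary ?Q v) a" using low0 by simp
    define u where "u = (\<lambda>y. v y - boundary X v s / incidence X t s * (if y = t then 1 else 0))"
    have bu: "boundary X u x = boundary ?Q v x" for x
      unfolding u_def by (rule boundary_lift[OF fin st'(1-3) vst])
    have bQ: "boundary ?Q v a \<noteq> 0" "\<And>x. x \<in> cells ?Q \<Longrightarrow> f a < f x \<Longrightarrow> boundary ?Q v x = 0"
      using low unfolding last_cell_def by auto
    have us: "boundary X u s = 0"
      using st'(3) boundary_single[OF fin st'(2)] unfolding u_def boundary_diff_scaled by simp
    \<comment> \<open>The lift may add \<open>t\<close> to the boundary, but never as its last cell: the boundary is a cycle,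
      so another cofacet of \<open>s\<close> occurs in it, and \<open>t\<close> is the first cofacet of \<open>s\<close>.\<close>
    have ut: "boundary X u t = 0" if at: "f a < f t"
    proof -
      have zero: "boundary X u y * incidence X y s = 0" if y: "y \<in> cells X - {t}" for y
      proof (rule ccontr)
        assume n: "\<not> ?thesis"
        then have "f t \<le> f y" using st' y by auto
        then have "f a < f y" using at by simp
        moreover have "y \<in> cells ?Q" using y n us by auto
        ultimately show False using n bQ(2) bu by simp
      qed
      have "(\<Sum>y\<in>cells X - {t}. boundary X u y * incidence X y s) = 0"
        by (intro sum.neutral ballI zero)
      moreover have "(\<Sum>y\<in>cells X. boundary X u y * incidence X y s) = 0"
        using boundary_boundary[OF X st'(1), of u] unfolding boundary_def[of X "boundary X u"] .
      ultimately have "boundary X u t * incidence X t s = 0"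
        using sum.remove[OF fin st'(2), of "\<lambda>y. boundary X u y * incidence X y s"] by simp
      then show ?thesis using st'(3) by simp
    qed
    have "last_cell X f (boundary X u) a"
      unfolding last_cell_def
    proof (intro conjI ballI impI)
      show "a \<in> cells X" "boundary X u a \<noteq> 0" using aX bu bQ by auto
      fix x assume x: "x \<in> cells X" "f a < f x"
      consider "x = s" | "x = t" | "x \<in> cells ?Q" using x by auto
      then show "boundary X u x = 0" using us ut bu bQ(2) x by cases auto
    qed
    moreover have "y \<in> D" if y: "y \<in> cells X" "u y \<noteq> 0" for y
    proof (cases "y = t")
      case True
      then have "boundary X v s \<noteq> 0" using y vst unfolding u_def by auto
      then obtain z where z: "z \<in> cells X" "v z * incidence X z s \<noteq> 0"
        unfolding boundary_def by (meson sum.neutral)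
      then have "f t \<le> f z" "z \<in> D" using st' vD by auto
      then show ?thesis using D True by blast
    next
      case False
      then show ?thesis using y vD unfolding u_def by auto
    qed
    ultimately show "a \<in> boundary_ends X f D" by (intro boundary_endsI[of X u]) auto
  next
    assume "a \<in> boundary_ends X f D"
    then obtain v where v: "\<And>y. y \<in> cells X \<Longrightarrow> v y \<noteq> 0 \<Longrightarrow> y \<in> D"
      and low: "last_cell X f (boundary X v) a" by (elim boundary_endsE) auto
    \<comment> \<open>Adding a multiple of the boundary of \<open>t\<close> removes \<open>s\<close> from the chain, at no cost in the
      support because \<open>s\<close> is the last facet of \<open>t\<close>.\<close>
    define w where "w = (\<lambda>y. v y - v s / incidence X t s * incidence X t y)"
    have ws: "w s = 0" using st'(3) unfolding w_def by simp
    have wD: "y \<in> D" if y: "y \<in> cells X" "w y \<noteq> 0" for y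
    proof (cases "v y = 0")
      case True
      then have "v s \<noteq> 0" "incidence X t y \<noteq> 0" using y unfolding w_def by auto
      then have "s \<in> D" "f y \<le> f s" using v st' y by auto
      then show ?thesis using D by blast
    next
      case False
      then show ?thesis using v y by blast
    qed
    have bw: "boundary X w x = boundary X v x" if "x \<in> cells X" for x
      unfolding w_def using boundary_diff_incidence[OF X st'(2) that] .
    define w' where "w' = (\<lambda>y. w y - w t * (if y = t then 1 else 0))"
    have w't: "w' t = 0" and w's: "w' s = 0" using lt ws unfolding w'_def by auto
    have bw': "boundary X w' x = boundary X v x - w t * incidence X t x" if "x \<in> cells X" for x
      unfolding w'_def boundary_diff_scaled boundary_single[OF fin st'(2)] bw[OF that] ..
    have bQ: "boundary ?Q w' x = boundary X v x - boundary X v s / incidence X t s * incidence X t x"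
      if "x \<in> cells X" for x
    proof -
      have "boundary ?Q w' x = boundary X w' x - boundary X w' s / incidence X t s * incidence X t x"
        unfolding boundary_lift[OF fin st'(1-3) w's w't, symmetric] boundary_diff_scaled
          boundary_single[OF fin st'(2)] ..
      then show ?thesis using bw' that st' by (simp add: field_simps)
    qed
    have va: "boundary X v a \<noteq> 0" "\<And>x. x \<in> cells X \<Longrightarrow> f a < f x \<Longrightarrow> boundary X v x = 0"
      using low unfolding last_cell_def by auto
    have corr: "boundary X v s / incidence X t s * incidence X t x = 0"
      if x: "x \<in> cells X" "f a \<le> f x" for x
    proof (rule ccontr)
      assume n: "\<not> ?thesis"
      then have "f x \<le> f s" "\<not> f a < f s" using x st' va(2) by auto
      then have "f a = f s" using x by simp
      then show False using inj aX st' by (auto dest: inj_onD)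
    qed
    have "last_cell ?Q f (boundary ?Q w') a"
      unfolding last_cell_def using a aX va bQ corr by auto
    moreover have "y \<in> D" if "y \<in> cells ?Q" "w' y \<noteq> 0" for y
      using wD[of y] that unfolding w'_def by auto
    ultimately show "a \<in> boundary_ends ?Q f D" by (intro boundary_endsI[of ?Q w']) auto
  qed
qed

text \<open>
  Together with \<open>boundary_ends_quotient\<close>, which handles the pairs of cells of the quotient, this
  shows that \<open>(s, t)\<close> is the only birth-death pair lost in the cancellation.
\<close>

lemma BD_meets_shallow_pair:
  fixes X :: "('a, 'k::field) lcomplex"
  assumes X: "lefschetz X" and f: "lfilter X f" and st: "(s, t) \<in> SH X f"
    and ab: "(a, b) \<in> BD X f" and meet: "{a, b} \<inter> {s, t} \<noteq> {}"
  shows "(a, b) = (s, t)"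
proof -
  note st' = shallow_pairD[OF st] and fin = lefschetz_finite[OF X] and inj = lfilter_inj[OF f]
  have bX: "b \<in> cells X" and nab: "a \<notin> boundary_ends X f {y. f y < f b}"
    using ab unfolding BD_iff[OF fin inj] by auto
  obtain v where v: "\<And>y. y \<in> cells X \<Longrightarrow> v y \<noteq> 0 \<Longrightarrow> f y \<le> f b"
    and low: "last_cell X f (boundary X v) a"
  proof -
    have "a \<in> boundary_ends X f {y. f y \<le> f b}" using ab unfolding BD_iff[OF fin inj] by blast
    then show thesis using that by (elim boundary_endsE) auto
  qed
  have aX: "a \<in> cells X" and va: "boundary X v a \<noteq> 0"
    and high: "\<And>x. x \<in> cells X \<Longrightarrow> f a < f x \<Longrightarrow> boundary X v x = 0"
    using low unfolding last_cell_def by auto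
  have before_t: "boundary X w s = 0" if "\<And>y. y \<in> cells X \<Longrightarrow> w y \<noteq> 0 \<Longrightarrow> f y < f t" for w
    unfolding boundary_def
  proof (intro sum.neutral ballI)
    fix y assume y: "y \<in> cells X"
    show "w y * incidence X y s = 0" using that[OF y] st'(5)[OF y] by force
  qed
  have "a \<noteq> t"
  proof
    \<comment> \<open>Otherwise the boundary of \<open>v\<close>, a cycle, contains \<open>t\<close> but no other cofacet of \<open>s\<close>.\<close>
    assume at: "a = t"
    have zero: "boundary X v y * incidence X y s = 0" if y: "y \<in> cells X - {t}" for y
    proof (rule ccontr)
      assume "\<not> ?thesis"
      then have "f t \<le> f y" "\<not> f t < f y" using st' high at y by auto
      then have "f t = f y" by simp
      then show False using inj y st' by (auto dest: inj_onD)
    qed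
    have "(\<Sum>y\<in>cells X - {t}. boundary X v y * incidence X y s) = 0"
      by (intro sum.neutral ballI zero)
    moreover have "(\<Sum>y\<in>cells X. boundary X v y * incidence X y s) = 0"
      using boundary_boundary[OF X st'(1), of v] unfolding boundary_def[of X "boundary X v"] .
    ultimately have "boundary X v t * incidence X t s = 0"
      using sum.remove[OF fin st'(2), of "\<lambda>y. boundary X v y * incidence X y s"] by simp
    then show False using st'(3) va at by simp
  qed
  moreover have "b \<noteq> s"
  proof
    \<comment> \<open>Otherwise the boundary of \<open>t\<close> can be used to remove \<open>s\<close> from \<open>v\<close>.\<close>
    assume bs: "b = s"
    define w where "w = (\<lambda>y. v y - v s / incidence X t s * incidence X t y)"
    have "f y < f b" if y: "y \<in> cells X" "w y \<noteq> 0" for y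
    proof -
      have "y \<noteq> s" using y st'(3) unfolding w_def by auto
      moreover have "f y \<le> f s" using y v[of y] st'(4)[of y] bs unfolding w_def by force
      ultimately show ?thesis using inj y st' bs by (metis inj_onD order_le_less)
    qed
    moreover have "last_cell X f (boundary X w) a"
      using low unfolding w_def
      by (rule last_cell_cong) (rule boundary_diff_incidence[OF X st'(2), symmetric])
    ultimately have "a \<in> boundary_ends X f {y. f y < f b}"
      by (intro boundary_endsI[of X w]) auto
    then show False using nab by blast
  qed
  moreover have "b = t" if as: "a = s"
  proof -
    have t_end: "s \<in> boundary_ends X f {y. f y \<le> f t}"
    proof (rule boundary_endsI)
      show "last_cell X f (boundary X (\<lambda>y. if y = t then 1 else 0)) s"
        unfolding last_cell_def boundary_single[OF fin st'(2)] using st' by force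
    qed (auto split: if_splits)
    have "\<not> f t < f b"
    proof
      assume "f t < f b"
      then have "{y. f y \<le> f t} \<subseteq> {y. f y < f b}" by auto
      then show False using t_end nab as unfolding boundary_ends_def by blast
    qed
    moreover have "\<not> f b < f t"
    proof
      assume "f b < f t"
      have "boundary X v s = 0"
      proof (rule before_t)
        fix y assume "y \<in> cells X" "v y \<noteq> 0"
        then show "f y < f t" using v[of y] \<open>f b < f t\<close> by linarith
      qed
      then show False using va as by simp
    qed
    ultimately show ?thesis using inj bX st' by (metis inj_onD linorder_neqE_linordered_idom)
  qed
  moreover have "a = s" if bt: "b = t"
  proof (rule ccontr)
    \<comment> \<open>Otherwise \<open>t\<close> can be dropped from \<open>v\<close>, since the boundary of \<open>t\<close> ends in \<open>s\<close>, before \<open>a\<close>.\<close>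
    assume as: "a \<noteq> s"
    define w where "w = (\<lambda>y. v y - v t * (if y = t then 1 else 0))"
    have w: "f y < f t" if y: "y \<in> cells X" "w y \<noteq> 0" for y
    proof -
      have "y \<noteq> t" "f y \<le> f t" using y v[of y] bt unfolding w_def by (auto split: if_splits)
      then show ?thesis using inj y st' by (metis inj_onD order_le_less)
    qed
    have bw: "boundary X w x = boundary X v x - v t * incidence X t x" for x
      unfolding w_def boundary_diff_scaled boundary_single[OF fin st'(2)] ..
    have "boundary X w s = 0" by (rule before_t) (rule w)
    then have "boundary X v s = v t * incidence X t s" using bw by simp
    then have "v t = 0 \<or> f s \<le> f a" using high[OF st'(1)] st'(3) by force
    then have "v t = 0 \<or> f s < f a" using inj aX st' as by (metis inj_onD order_le_less)
    then have "v t * incidence X t x = 0" if "x \<in> cells X" "f a \<le> f x" for x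
      using st'(4)[of x] that by force
    then have "last_cell X f (boundary X w) a"
      using bw by (intro last_cell_cong[OF low]) auto
    then have "a \<in> boundary_ends X f {y. f y < f b}"
      using w bt by (intro boundary_endsI[of X w]) auto
    then show False using nab by blast
  qed
  ultimately show ?thesis using meet by auto
qed

lemma BD_quotient:
  fixes X :: "('a, 'k::field) lcomplex"
  assumes X: "lefschetz X" and f: "lfilter X f" and p: "p \<in> SH X f"
  shows "BD (quotient X p) f = BD X f - {p}"
proof -
  obtain s t where pst: "p = (s, t)" by (metis surj_pair)
  let ?Q = "quotient X (s, t)"
  have st: "(s, t) \<in> SH X f" using p pst by simp
  note st' = shallow_pairD[OF st] and fin = lefschetz_finite[OF X] and inj = lfilter_inj[OF f]
  have finQ: "finite (cells ?Q)"
    using fin by simp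
  have injQ: "inj_on f (cells ?Q)" using lfilter_inj[OF lfilter_quotient[OF f st]] .
  have cellsD: "a \<in> cells Y \<and> b \<in> cells Y" if "(a, b) \<in> BD Y f" for Y :: "('a, 'k) lcomplex" and a b
    using that unfolding BD_def pivot_def by blast
  have eq: "(a, b) \<in> BD ?Q f \<longleftrightarrow> (a, b) \<in> BD X f" if a: "a \<in> cells ?Q" and b: "b \<in> cells ?Q" for a b
    unfolding BD_iff[OF finQ injQ] BD_iff[OF fin inj]
    using a b boundary_ends_quotient[OF X f st _ a, of "{y. f y \<le> f b}"]
      boundary_ends_quotient[OF X f st _ a, of "{y. f y < f b}"] by auto
  have "(a, b) \<in> BD ?Q f \<longleftrightarrow> (a, b) \<in> BD X f - {(s, t)}" for a b
  proof
    assume h: "(a, b) \<in> BD ?Q f"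
    have "a \<in> cells ?Q" "b \<in> cells ?Q" using cellsD[OF h] by auto
    then show "(a, b) \<in> BD X f - {(s, t)}" using h eq by auto
  next
    assume h: "(a, b) \<in> BD X f - {(s, t)}"
    then have "{a, b} \<inter> {s, t} = {}" using BD_meets_shallow_pair[OF X f st] by blast
    moreover have "a \<in> cells X" "b \<in> cells X" using h cellsD by auto
    ultimately show "(a, b) \<in> BD ?Q f" using h eq by auto
  qed
  then show ?thesis unfolding pst by auto
qed

section \<open>Sequences of shallow cancellations\<close>

primrec shallow_seq ::
    "('a, 'k::field) lcomplex \<Rightarrow> ('a \<Rightarrow> real) \<Rightarrow> ('a \<times> 'a) list \<Rightarrow> bool" where
  "shallow_seq X f [] \<longleftrightarrow> True"
| "shallow_seq X f (p # ps) \<longleftrightarrow> p \<in> SH X f \<and> shallow_seq (quotient X p) f ps"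

lemma quotients_simps [simp]:
  "quotients X [] = X"
  "quotients X (p # ps) = quotients (quotient X p) ps"
  by (simp_all add: quotients_def)

lemma shallow_seq_nth:
  "shallow_seq X f ps \<longleftrightarrow> (\<forall>i<length ps. ps ! i \<in> SH (quotients X (take i ps)) f)"
  by (induction ps arbitrary: X) (simp_all add: All_less_Suc2)

lemma shallow_order_iff:
  "shallow_order X f \<Phi> \<longleftrightarrow> distinct \<Phi> \<and> set \<Phi> = BD X f \<and> shallow_seq X f \<Phi>"
  by (simp add: shallow_order_def shallow_seq_nth)

lemma shallow_seq_append:
  "shallow_seq X f (ps @ qs) \<longleftrightarrow> shallow_seq X f ps \<and> shallow_seq (quotients X ps) f qs"
  by (induction ps arbitrary: X) simp_all

lemma quotient_SH_preserves:
  assumes "lefschetz X" "lfilter X f" "p \<in> SH X f"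
  shows "lefschetz (quotient X p)" "lfilter (quotient X p) f"
  using assms by (cases p; auto intro!: lefschetz_quotient lfilter_quotient dest: shallow_pairD(1-3))+

lemma BD_quotients:
  assumes "lefschetz X" "lfilter X f" "shallow_seq X f ps"
  shows "BD (quotients X ps) f = BD X f - set ps"
  using assms
proof (induction ps arbitrary: X)
  case (Cons p ps)
  then have p: "p \<in> SH X f" and ps: "shallow_seq (quotient X p) f ps" by auto
  have "BD (quotients (quotient X p) ps) f = BD (quotient X p) f - set ps"
    using Cons.IH quotient_SH_preserves[OF Cons.prems(1,2) p] ps by blast
  then show ?case using BD_quotient[OF Cons.prems(1,2) p] by auto
qed simp

text \<open>
  By induction along the sequence, \<open>p\<close> is moved forward past one pair at a time. If \<open>p\<close> is not in
  the sequence, the lemma says that canceling \<open>p\<close> first leaves the sequence shallow.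
\<close>

lemma shallow_seq_remove1:
  assumes "lefschetz X" "lfilter X f" "p \<in> SH X f" "shallow_seq X f qs"
  shows "shallow_seq (quotient X p) f (remove1 p qs)"
  using assms
proof (induction qs arbitrary: X)
  case (Cons q qs)
  show ?case
  proof (cases "p = q")
    case True
    then show ?thesis using Cons.prems by simp
  next
    case False
    have q: "q \<in> SH X f" and qs: "shallow_seq (quotient X q) f qs" using Cons.prems by auto
    have "shallow_seq (quotient (quotient X q) p) f (remove1 p qs)"
      using Cons.IH quotient_SH_preserves[OF Cons.prems(1,2) q] qs
        SH_quotient[OF Cons.prems(1,2) q Cons.prems(3)] False by auto
    then show ?thesis
      using False quotient_commute[OF Cons.prems(1-3) q] SH_quotient[OF Cons.prems(1-3) q] by simp
  qed
qed simp

lemma shallow_seq_filter: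
  assumes "lefschetz X" "lfilter X f" "shallow_seq X f ps" "shallow_seq X f qs" "distinct qs"
  shows "shallow_seq (quotients X ps) f (filter (\<lambda>q. q \<notin> set ps) qs)"
  using assms
proof (induction ps arbitrary: X qs)
  case (Cons p ps)
  have p: "p \<in> SH X f" and ps: "shallow_seq (quotient X p) f ps" using Cons.prems by auto
  have "shallow_seq (quotients (quotient X p) ps) f (filter (\<lambda>q. q \<notin> set ps) (remove1 p qs))"
    using Cons.IH[OF quotient_SH_preserves[OF Cons.prems(1,2) p] ps]
      shallow_seq_remove1[OF Cons.prems(1,2) p Cons.prems(4)] Cons.prems(5) by simp
  moreover have "filter (\<lambda>q. q \<notin> set ps) (remove1 p qs) = filter (\<lambda>q. q \<notin> set (p # ps)) qs"
    using Cons.prems(5)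
    by (auto simp: distinct_remove1_removeAll removeAll_filter_not_eq intro!: filter_cong)
  ultimately show ?case by simp
qed simp

section \<open>The depth poset after cancellation\<close>

lemma list_order_Cons: "list_order (x # xs) = {x} \<times> set (x # xs) \<union> list_order xs"
proof (intro set_eqI iffI)
  fix p assume "p \<in> list_order (x # xs)"
  then obtain i j where ij: "p = ((x # xs) ! i, (x # xs) ! j)" "i \<le> j" "j < length (x # xs)"
    unfolding list_order_def by blast
  show "p \<in> {x} \<times> set (x # xs) \<union> list_order xs"
  proof (cases i)
    case 0
    then show ?thesis using ij nth_mem[OF ij(3)] by auto
  next
    case (Suc i')
    then obtain j' where "j = Suc j'" using ij by (cases j) auto
    then show ?thesis using ij Suc unfolding list_order_def by auto
  qed
next
  fix p assume "p \<in> {x} \<times> set (x # xs) \<union> list_order xs"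
  then show "p \<in> list_order (x # xs)"
  proof
    assume "p \<in> {x} \<times> set (x # xs)"
    then obtain j where "p = (x, (x # xs) ! j)" "j < length (x # xs)"
      by (metis SigmaE in_set_conv_nth singletonD)
    then show ?thesis unfolding list_order_def by (intro CollectI exI[of _ 0] exI[of _ j]) simp
  next
    assume "p \<in> list_order xs"
    then obtain i j where "p = (xs ! i, xs ! j)" "i \<le> j" "j < length xs"
      unfolding list_order_def by blast
    then show ?thesis
      unfolding list_order_def by (intro CollectI exI[of _ "Suc i"] exI[of _ "Suc j"]) simp
  qed
qed

lemma list_order_filter: "list_order (filter P xs) = list_order xs \<inter> (Collect P \<times> Collect P)"
proof (induction xs)
  case Nil
  show ?case by (simp add: list_order_def)
next
  case (Cons x xs)
  have "list_order xs \<subseteq> set xs \<times> set xs" unfolding list_order_def by auto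
  with Cons show ?case by (auto simp: list_order_Cons)
qed

theorem proposition7p10:
  fixes X XS :: "('a, 'k::field) lcomplex" and f :: "'a \<Rightarrow> real" and S :: "('a \<times> 'a) set"
  assumes "lefschetz X" and "lfilter X f"
    and "shallow_cancelable X f S" and "shallow_cancellation X f S XS"
  shows "depth_poset XS f = depth_poset X f \<inter> ((BD X f - S) \<times> (BD X f - S))"
proof -
  note X = assms(1) and f = assms(2)
  obtain \<Phi> k where \<Phi>: "shallow_order X f \<Phi>" and S: "S = set (take k \<Phi>)"
    and XS: "XS = quotients X (take k \<Phi>)"
    using assms(4) unfolding shallow_cancellation_def by blast
  define A where "A = take k \<Phi>"
  have A: "shallow_seq X f A" "distinct A" "set A \<subseteq> BD X f"
    using \<Phi> shallow_seq_append[of X f A "drop k \<Phi>"] set_take_subset[of k \<Phi>]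
    unfolding shallow_order_iff A_def by auto
  have SA: "S = set A" and XSA: "XS = quotients X A" using S XS A_def by auto
  have BDS: "BD XS f = BD X f - S" using BD_quotients[OF X f A(1)] SA XSA by simp
  have extend: "shallow_order X f (A @ \<Psi>) \<and> filter (\<lambda>q. q \<notin> S) (A @ \<Psi>) = \<Psi>"
    if "shallow_order XS f \<Psi>" for \<Psi>
    using that A BDS unfolding shallow_order_iff shallow_seq_append SA XSA
    by (auto simp: filter_id_conv)
  have restrict: "shallow_order XS f (filter (\<lambda>q. q \<notin> S) \<Theta>)" if "shallow_order X f \<Theta>" for \<Theta>
    using that shallow_seq_filter[OF X f A(1)] BDS unfolding shallow_order_iff SA XSA by auto
  have orders: "(\<forall>\<Psi>. shallow_order XS f \<Psi> \<longrightarrow> (\<chi>, \<xi>) \<in> list_order \<Psi>)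
      \<longleftrightarrow> (\<forall>\<Theta>. shallow_order X f \<Theta> \<longrightarrow> (\<chi>, \<xi>) \<in> list_order \<Theta>)"
    if "\<chi> \<notin> S" "\<xi> \<notin> S" for \<chi> \<xi>
  proof -
    have "(\<chi>, \<xi>) \<in> list_order (filter (\<lambda>q. q \<notin> S) \<Theta>) \<longleftrightarrow> (\<chi>, \<xi>) \<in> list_order \<Theta>" for \<Theta>
      using that by (simp add: list_order_filter)
    then show ?thesis using extend restrict by metis
  qed
  have "(\<chi>, \<xi>) \<in> depth_poset XS f
      \<longleftrightarrow> (\<chi>, \<xi>) \<in> depth_poset X f \<inter> ((BD X f - S) \<times> (BD X f - S))" for \<chi> \<xi>
    unfolding depth_poset_def BDS using orders[of \<chi> \<xi>] by blast
  then show ?thesis by auto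
qed

end
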